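(* The infinite dihedral group $D_\infty$ is monomial; that is, every irreducible complex representation of $D_\infty$ is isomorphic to $\mathrm{Ind}_H^{D_\infty}(\chi)$ for some subgroup $H$ of $D_\infty$ and some character $\chi: H\to\mathbb{C}^\times$.
   Context: The infinite dihedral group $D_\infty$ is the set of pairs $(s,z)$ with $s\in\{1,-1\}$ and $z \in \mathbb{Z}$, with multiplication $(s,z)(s',z') = (ss', s'z + z')$. Representations are abstract (possibly infinite dimensional, not necessarily unitary) complex representations; irreducible means nonzero with no proper nonzero invariant subspace (algebraically). A character of a group is a one-dimensional complex representation. Induction is finite (compact) induction: for a representation $(\rho, W)$ of a subgroup $H$ of a group $G$, $\mathrm{Ind}_H^G(\rho)$ is the space of functions $f : G \to W$ with $f(hg) = \rho(h) f(g)$ for all $h \in H$, $g \in G$, and with support contained in a finite union of right cosets $Hx$ of $H$ in $G$, on which $G$ acts by right translation $(g\cdot f)(x) = f(xg)$. *)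

theory Defs
  imports Complex_Main "HOL-Algebra.Coset" "HOL-Library.Function_Algebras"
begin

definition Dinf :: "(int \<times> int) monoid" where
  "Dinf = \<lparr>carrier = {1, -1} \<times> UNIV,
           mult = (\<lambda>(s, z) (s', z'). (s * s', s' * z + z')),
           one = (1, 0)\<rparr>"

lemma group_Dinf: "group Dinf"
proof (rule groupI)
  fix x assume "x \<in> carrier Dinf"
  then obtain s z where x: "x = (s, z)" "s \<in> {1, -1}"
    by (auto simp: Dinf_def)
  have "(s, - s * z) \<in> carrier Dinf" "(s, - s * z) \<otimes>\<^bsub>Dinf\<^esub> x = \<one>\<^bsub>Dinf\<^esub>"
    using x by (auto simp: Dinf_def)
  then show "\<exists>y\<in>carrier Dinf. y \<otimes>\<^bsub>Dinf\<^esub> x = \<one>\<^bsub>Dinf\<^esub>" by blast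
qed (auto simp: Dinf_def algebra_simps)

text \<open>A complex representation lives on a subspace \<open>V\<close> of an ambient complex vector space; the
  operators \<open>\<rho> g\<close> are only constrained on \<open>V\<close>, and only for \<open>g\<close> in the carrier of the group.\<close>

locale group_rep = group G + vector_space scale
  for G :: "'g monoid" (structure)
    and scale :: "complex \<Rightarrow> 'v::ab_group_add \<Rightarrow> 'v" (infixr "*s" 75) +
  fixes V :: "'v set" and \<rho> :: "'g \<Rightarrow> 'v \<Rightarrow> 'v"
  assumes subspace_V: "subspace V"
    and rep_closed: "\<lbrakk>g \<in> carrier G; v \<in> V\<rbrakk> \<Longrightarrow> \<rho> g v \<in> V"
    and rep_add: "\<lbrakk>g \<in> carrier G; v \<in> V; w \<in> V\<rbrakk> \<Longrightarrow> \<rho> g (v + w) = \<rho> g v + \<rho> g w"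
    and rep_scale: "\<lbrakk>g \<in> carrier G; v \<in> V\<rbrakk> \<Longrightarrow> \<rho> g (c *s v) = c *s \<rho> g v"
    and rep_one: "v \<in> V \<Longrightarrow> \<rho> \<one> v = v"
    and rep_mult: "\<lbrakk>g \<in> carrier G; h \<in> carrier G; v \<in> V\<rbrakk> \<Longrightarrow> \<rho> (g \<otimes> h) v = \<rho> g (\<rho> h v)"

locale irreducible_rep = group_rep +
  assumes nonzero: "V \<noteq> {0}"
    and irreducible: "\<lbrakk>subspace W; W \<subseteq> V; \<And>g w. \<lbrakk>g \<in> carrier G; w \<in> W\<rbrakk> \<Longrightarrow> \<rho> g w \<in> W\<rbrakk>
      \<Longrightarrow> W = {0} \<or> W = V"

definition rep_isomorphic ::
  "'g monoid \<Rightarrow> (complex \<Rightarrow> 'v::ab_group_add \<Rightarrow> 'v) \<Rightarrow> 'v set \<Rightarrow> ('g \<Rightarrow> 'v \<Rightarrow> 'v)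
    \<Rightarrow> (complex \<Rightarrow> 'w::ab_group_add \<Rightarrow> 'w) \<Rightarrow> 'w set \<Rightarrow> ('g \<Rightarrow> 'w \<Rightarrow> 'w) \<Rightarrow> bool" where
  "rep_isomorphic G scale V \<rho> scale' V' \<rho>' \<longleftrightarrow>
    (\<exists>T. bij_betw T V V' \<and>
      (\<forall>v\<in>V. \<forall>w\<in>V. T (v + w) = T v + T w) \<and>
      (\<forall>c. \<forall>v\<in>V. T (scale c v) = scale' c (T v)) \<and>
      (\<forall>g\<in>carrier G. \<forall>v\<in>V. T (\<rho> g v) = \<rho>' g (T v)))"

definition fun_scale :: "(complex \<Rightarrow> 'w \<Rightarrow> 'w) \<Rightarrow> complex \<Rightarrow> ('g \<Rightarrow> 'w) \<Rightarrow> 'g \<Rightarrow> 'w" where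
  "fun_scale scale c f = (\<lambda>x. scale c (f x))"

text \<open>A function on the group is encoded by its extension by \<open>0\<close> to the whole type, so that the
  induced space is a subspace of the full function space with pointwise operations.\<close>

definition ind_space ::
  "'g monoid \<Rightarrow> 'g set \<Rightarrow> 'w::ab_group_add set \<Rightarrow> ('g \<Rightarrow> 'w \<Rightarrow> 'w) \<Rightarrow> ('g \<Rightarrow> 'w) set" where
  "ind_space G H W \<sigma> =
    {f. (\<forall>x\<in>carrier G. f x \<in> W) \<and> (\<forall>x. x \<notin> carrier G \<longrightarrow> f x = 0) \<and>
        (\<forall>h\<in>H. \<forall>g\<in>carrier G. f (h \<otimes>\<^bsub>G\<^esub> g) = \<sigma> h (f g)) \<and>
        (\<exists>C. finite C \<and> C \<subseteq> rcosets\<^bsub>G\<^esub> H \<and> {x \<in> carrier G. f x \<noteq> 0} \<subseteq> \<Union>C)}"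

definition ind_act :: "'g monoid \<Rightarrow> 'g \<Rightarrow> ('g \<Rightarrow> 'w::zero) \<Rightarrow> 'g \<Rightarrow> 'w" where
  "ind_act G g f = (\<lambda>x. if x \<in> carrier G then f (x \<otimes>\<^bsub>G\<^esub> g) else 0)"

definition complex_units :: "complex monoid" where
  "complex_units = \<lparr>carrier = UNIV - {0}, mult = (*), one = 1\<rparr>"

text \<open>A character is given by its values; the one-dimensional representation it stands for is
  \<open>char_rep\<close>, acting on the vector space of complex numbers.\<close>

definition characters :: "'g monoid \<Rightarrow> ('g \<Rightarrow> complex) set" where
  "characters G = hom G complex_units"

definition char_rep :: "('g \<Rightarrow> complex) \<Rightarrow> 'g \<Rightarrow> complex \<Rightarrow> complex" where
  "char_rep \<chi> h w = \<chi> h * w"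

lemma group_rep_char:
  assumes "group G" "\<chi> \<in> characters G"
  shows "group_rep G (*) UNIV (char_rep \<chi>)"
proof -
  interpret G: group G by fact
  have vs: "vector_space ((*) :: complex \<Rightarrow> complex \<Rightarrow> complex)"
    by unfold_locales (simp_all add: algebra_simps)
  have mult: "\<chi> (x \<otimes>\<^bsub>G\<^esub> y) = \<chi> x * \<chi> y" if "x \<in> carrier G" "y \<in> carrier G" for x y
    using assms that by (auto simp: characters_def hom_def complex_units_def)
  have nz: "\<chi> \<one>\<^bsub>G\<^esub> \<noteq> 0"
    using assms by (auto simp: characters_def hom_def complex_units_def)
  have "\<chi> \<one>\<^bsub>G\<^esub> = 1" using mult[of "\<one>\<^bsub>G\<^esub>" "\<one>\<^bsub>G\<^esub>"] nz by simp
  then show ?thesis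
    by (intro group_rep.intro group_rep_axioms.intro G.group_axioms vs
        module.subspace_UNIV[OF vs[folded module_iff_vector_space]]) (simp_all add: char_rep_def algebra_simps mult)
qed

lemma vector_space_fun_scale:
  assumes "vector_space scale"
  shows "vector_space (fun_scale scale)"
proof -
  interpret vector_space scale by fact
  show ?thesis
    by unfold_locales (auto simp: fun_scale_def scale_right_distrib scale_left_distrib)
qed

lemma group_rep_ind:
  assumes "group G" "subgroup H G" "group_rep (G\<lparr>carrier := H\<rparr>) scale W \<sigma>"
  shows "group_rep G (fun_scale scale) (ind_space G H W \<sigma>) (ind_act G)"
proof -
  interpret G: group G by fact
  interpret H: subgroup H G by fact
  interpret R: group_rep "G\<lparr>carrier := H\<rparr>" scale W \<sigma> by fact
  interpret F: vector_space "fun_scale scale"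
    by (rule vector_space_fun_scale) (rule R.vector_space_axioms)
  let ?S = "\<lambda>f. \<exists>C. finite C \<and> C \<subseteq> rcosets\<^bsub>G\<^esub> H \<and> {x \<in> carrier G. f x \<noteq> 0} \<subseteq> \<Union>C"
  have W0: "0 \<in> W" and Wadd: "\<And>v w. v \<in> W \<Longrightarrow> w \<in> W \<Longrightarrow> v + w \<in> W"
    and Wsc: "\<And>c v. v \<in> W \<Longrightarrow> scale c v \<in> W"
    using R.subspace_V by (simp_all add: R.subspace_def)
  have \<sigma>0: "\<sigma> h 0 = 0" if "h \<in> H" for h
    using R.rep_scale[of h 0 0] that W0 by simp
  have indI: "f \<in> ind_space G H W \<sigma>"
    if "\<And>x. x \<in> carrier G \<Longrightarrow> f x \<in> W" "\<And>x. x \<notin> carrier G \<Longrightarrow> f x = 0"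
      "\<And>h g. h \<in> H \<Longrightarrow> g \<in> carrier G \<Longrightarrow> f (h \<otimes>\<^bsub>G\<^esub> g) = \<sigma> h (f g)" "?S f" for f
    unfolding ind_space_def mem_Collect_eq using that by blast
  have indD: "x \<in> carrier G \<Longrightarrow> f x \<in> W" "x \<notin> carrier G \<Longrightarrow> f x = 0"
      "h \<in> H \<Longrightarrow> x \<in> carrier G \<Longrightarrow> f (h \<otimes>\<^bsub>G\<^esub> x) = \<sigma> h (f x)" "?S f"
    if "f \<in> ind_space G H W \<sigma>" for f x h
    using that unfolding ind_space_def mem_Collect_eq by blast+
  have sub: "F.subspace (ind_space G H W \<sigma>)"
  proof (rule F.subspaceI)
    show "0 \<in> ind_space G H W \<sigma>"
      by (rule indI) (simp_all add: W0 \<sigma>0 exI[of _ "{}"])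
  next
    fix f f' assume a: "f \<in> ind_space G H W \<sigma>" "f' \<in> ind_space G H W \<sigma>"
    obtain C where C: "finite C" "C \<subseteq> rcosets\<^bsub>G\<^esub> H" "{x \<in> carrier G. f x \<noteq> 0} \<subseteq> \<Union>C"
      using indD(4)[OF a(1)] by blast
    obtain D where D: "finite D" "D \<subseteq> rcosets\<^bsub>G\<^esub> H" "{x \<in> carrier G. f' x \<noteq> 0} \<subseteq> \<Union>D"
      using indD(4)[OF a(2)] by blast
    have "{x \<in> carrier G. (f + f') x \<noteq> 0} \<subseteq> \<Union>(C \<union> D)"
    proof
      fix x assume x: "x \<in> {x \<in> carrier G. (f + f') x \<noteq> 0}"
      then have "f x \<noteq> 0 \<or> f' x \<noteq> 0" by auto
      with x C(3) D(3) show "x \<in> \<Union>(C \<union> D)" by blast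
    qed
    moreover have "finite (C \<union> D)" "C \<union> D \<subseteq> rcosets\<^bsub>G\<^esub> H"
      using C(1,2) D(1,2) by simp_all
    ultimately have "?S (f + f')" by blast
    then show "f + f' \<in> ind_space G H W \<sigma>"
      by (intro indI) (simp_all add: indD(1-3)[OF a(1)] indD(1-3)[OF a(2)] Wadd R.rep_add)
  next
    fix c f assume a: "f \<in> ind_space G H W \<sigma>"
    obtain C where C: "finite C" "C \<subseteq> rcosets\<^bsub>G\<^esub> H" "{x \<in> carrier G. f x \<noteq> 0} \<subseteq> \<Union>C"
      using indD(4)[OF a] by blast
    have "{x \<in> carrier G. fun_scale scale c f x \<noteq> 0} \<subseteq> {x \<in> carrier G. f x \<noteq> 0}"
      by (auto simp: fun_scale_def)
    with C(3) have "{x \<in> carrier G. fun_scale scale c f x \<noteq> 0} \<subseteq> \<Union>C"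
      by (rule subset_trans[rotated])
    with C(1,2) have "?S (fun_scale scale c f)" by blast
    then show "fun_scale scale c f \<in> ind_space G H W \<sigma>"
      by (intro indI) (simp_all add: indD(1-3)[OF a] Wsc R.rep_scale fun_scale_def)
  qed
  have closed: "ind_act G g f \<in> ind_space G H W \<sigma>"
    if g: "g \<in> carrier G" and f: "f \<in> ind_space G H W \<sigma>" for g f
  proof -
    obtain C where C: "finite C" "C \<subseteq> rcosets\<^bsub>G\<^esub> H" "{x \<in> carrier G. f x \<noteq> 0} \<subseteq> \<Union>C"
      using indD(4)[OF f] by blast
    let ?D = "(\<lambda>S. S #>\<^bsub>G\<^esub> inv\<^bsub>G\<^esub> g) ` C"
    have "S #>\<^bsub>G\<^esub> inv\<^bsub>G\<^esub> g \<in> rcosets\<^bsub>G\<^esub> H" if S: "S \<in> C" for S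
    proof -
      obtain a where a: "a \<in> carrier G" "S = H #>\<^bsub>G\<^esub> a"
        using C(2) S unfolding RCOSETS_def by blast
      then have "S #>\<^bsub>G\<^esub> inv\<^bsub>G\<^esub> g = H #>\<^bsub>G\<^esub> (a \<otimes>\<^bsub>G\<^esub> inv\<^bsub>G\<^esub> g)"
        using g by (simp add: G.coset_mult_assoc H.subset)
      then show ?thesis using a(1) g by (simp add: G.rcosetsI H.subset)
    qed
    then have D: "finite ?D" "?D \<subseteq> rcosets\<^bsub>G\<^esub> H" using C(1) by blast+
    have "{x \<in> carrier G. ind_act G g f x \<noteq> 0} \<subseteq> \<Union>?D"
    proof
      fix x assume "x \<in> {x \<in> carrier G. ind_act G g f x \<noteq> 0}"
      then have x: "x \<in> carrier G" "f (x \<otimes>\<^bsub>G\<^esub> g) \<noteq> 0" by (simp_all add: ind_act_def split: if_splits)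
      then have "x \<otimes>\<^bsub>G\<^esub> g \<in> \<Union>C" using C(3) g by blast
      then obtain S where S: "S \<in> C" "x \<otimes>\<^bsub>G\<^esub> g \<in> S" by blast
      have "x = (x \<otimes>\<^bsub>G\<^esub> g) \<otimes>\<^bsub>G\<^esub> inv\<^bsub>G\<^esub> g" using x g by (simp add: G.m_assoc)
      then have "x \<in> S #>\<^bsub>G\<^esub> inv\<^bsub>G\<^esub> g" using S(2) unfolding r_coset_def by blast
      with S(1) show "x \<in> \<Union>?D" by blast
    qed
    with D have "?S (ind_act G g f)" by blast
    then show ?thesis
      by (intro indI) (simp_all add: indD(1-3)[OF f] g ind_act_def G.m_assoc)
  qed
  have one: "ind_act G \<one>\<^bsub>G\<^esub> f = f" if "f \<in> ind_space G H W \<sigma>" for f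
    using indD(2)[OF that] by (simp add: ind_act_def fun_eq_iff)
  show ?thesis
    by (intro group_rep.intro group_rep_axioms.intro G.group_axioms F.vector_space_axioms sub
        closed one) (simp_all add: ind_act_def fun_scale_def fun_eq_iff G.m_assoc)
qed

end

theory Submission
  imports Defs "HOL-Computational_Algebra.Fundamental_Theorem_Algebra"
begin

text \<open>
  Write \<open>t\<close> for the unit translation and \<open>s\<close> for the reflection, so that \<open>s t s = t\<^sup>-\<^sup>1\<close>.
  Everything rests on the existence of an eigenvector \<open>u\<close> of \<open>t\<close> in the possibly
  infinite-dimensional space \<open>V\<close> (\<open>translation_eigenvector\<close>). To find it, take \<open>v \<noteq> 0\<close> with
  \<open>s v = \<plusminus>v\<close> and consider the subspace spanned by all \<open>t\<^sup>n v - t\<^sup>n\<^sup>+\<^sup>1 v\<close>. It is invariant under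
  \<open>t\<close> and \<open>s\<close>, so it is zero or \<open>V\<close>. In the first case \<open>t v = v\<close>. In the second case it contains
  \<open>v\<close>, which yields a nonzero polynomial in \<open>t\<close> killing \<open>v\<close>; over the complex numbers this
  polynomial splits, and some linear factor of it has a nonzero kernel
  (\<open>eigenvector_if_annihilated\<close>).

  Let \<open>t u = \<mu> u\<close>; then \<open>t (s u) = \<mu>\<^sup>-\<^sup>1 (s u)\<close>, and \<open>u\<close>, \<open>s u\<close> span \<open>V\<close>. If \<open>\<mu>\<^sup>2 = 1\<close>, then
  \<open>u + s u\<close> or \<open>u\<close> spans an invariant line, so \<open>V\<close> is one-dimensional and is induced from the
  whole group. Otherwise \<open>u\<close>, \<open>s u\<close> is a basis of \<open>V\<close>, the coordinate of \<open>u\<close> is equivariant for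
  the subgroup of translations and its character \<open>n \<mapsto> \<mu>\<^sup>n\<close>, and Frobenius reciprocity
  (\<open>isomorphic_ind_if_functional\<close>) identifies \<open>V\<close> with the representation induced from it.
\<close>

section \<open>Invariant subspaces and polynomials in a group element\<close>

context group_rep
begin

lemma V_closed:
  shows V_zero: "0 \<in> V" and V_add: "\<lbrakk>v \<in> V; w \<in> V\<rbrakk> \<Longrightarrow> v + w \<in> V"
    and V_scale: "v \<in> V \<Longrightarrow> c *s v \<in> V"
  using subspace_V by (simp_all add: subspace_def)

lemma V_diff: "\<lbrakk>v \<in> V; w \<in> V\<rbrakk> \<Longrightarrow> v - w \<in> V"
  using subspace_V by (rule subspace_diff)

lemma V_sum: "(\<And>i. i \<in> S \<Longrightarrow> f i \<in> V) \<Longrightarrow> sum f S \<in> V"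
  using subspace_V by (rule subspace_sum)

lemma span_subset_V: "S \<subseteq> V \<Longrightarrow> span S \<subseteq> V"
  using subspace_V by (rule span_minimal[rotated])

lemma rep_zero: "g \<in> carrier G \<Longrightarrow> \<rho> g 0 = 0"
  using rep_scale[of g 0 0] V_zero by simp

lemma rep_diff: "\<lbrakk>g \<in> carrier G; v \<in> V; w \<in> V\<rbrakk> \<Longrightarrow> \<rho> g (v - w) = \<rho> g v - \<rho> g w"
  using rep_add[of g "v - w" w] V_diff[of v w] by simp

lemma rep_sum:
  assumes "g \<in> carrier G" "\<And>i. i \<in> S \<Longrightarrow> f i \<in> V"
  shows "\<rho> g (sum f S) = (\<Sum>i\<in>S. \<rho> g (f i))"
  using assms(2)
proof (induction S rule: infinite_finite_induct)
  case (insert x F)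
  then show ?case using assms(1) by (simp add: rep_add V_sum)
qed (use assms(1) in \<open>simp_all add: rep_zero\<close>)

lemma rep_inj:
  assumes "g \<in> carrier G" "v \<in> V" "\<rho> g v = 0"
  shows "v = 0"
  using rep_mult[of "inv g" g v] rep_one[of v] rep_zero[of "inv g"] assms by simp

lemma rep_span:
  assumes S: "S \<subseteq> V" and g: "g \<in> carrier G" and gen: "\<And>x. x \<in> S \<Longrightarrow> \<rho> g x \<in> span S"
    and w: "w \<in> span S"
  shows "\<rho> g w \<in> span S"
proof -
  have "w \<in> V \<and> \<rho> g w \<in> span S"
    using w
  proof (induction rule: span_induct_alt)
    case base
    then show ?case using g by (simp add: V_zero rep_zero span_zero)
  next
    case (step c x y)
    moreover have "x \<in> V" using S step by blast
    ultimately show ?case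
      using g gen by (simp add: V_add V_scale rep_add rep_scale span_add span_scale)
  qed
  then show ?thesis ..
qed

text \<open>The vector \<open>p(g) u\<close>, where the polynomial \<open>p\<close> is evaluated at \<open>g\<close> in the group algebra.\<close>

definition poly_act :: "'g \<Rightarrow> complex poly \<Rightarrow> 'v \<Rightarrow> 'v" where
  "poly_act g p u = (\<Sum>i\<le>degree p. coeff p i *s \<rho> (g [^] i) u)"

lemma poly_act_altdef:
  assumes "degree p \<le> n"
  shows "poly_act g p u = (\<Sum>i\<le>n. coeff p i *s \<rho> (g [^] i) u)"
  unfolding poly_act_def
  by (rule sum.mono_neutral_left) (use assms in \<open>auto simp: coeff_eq_0\<close>)

lemma poly_act_in_V: "\<lbrakk>g \<in> carrier G; u \<in> V\<rbrakk> \<Longrightarrow> poly_act g p u \<in> V"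
  unfolding poly_act_def by (intro V_sum V_scale rep_closed nat_pow_closed)

lemma poly_act_0: "poly_act g 0 u = 0"
  by (simp add: poly_act_def)

lemma poly_act_add: "poly_act g (p + q) u = poly_act g p u + poly_act g q u"
  using poly_act_altdef[of p "max (degree p) (degree q)" g u]
    poly_act_altdef[of q "max (degree p) (degree q)" g u]
    poly_act_altdef[of "p + q" "max (degree p) (degree q)" g u]
  by (simp add: degree_add_le_max scale_left_distrib sum.distrib)

lemma poly_act_smult: "poly_act g (smult c p) u = c *s poly_act g p u"
  using poly_act_altdef[of "smult c p" "degree p" g u]
  by (simp add: poly_act_def scale_sum_right)

lemma poly_act_diff: "poly_act g (p - q) u = poly_act g p u - poly_act g q u"
  using poly_act_add[of g "p - q" q u] by (simp add: algebra_simps)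

lemma poly_act_monom: "poly_act g (monom c n) u = c *s \<rho> (g [^] n) u"
proof -
  have "poly_act g (monom c n) u = (\<Sum>i\<le>n. if i = n then c *s \<rho> (g [^] n) u else 0)"
    unfolding poly_act_altdef[OF degree_monom_le] by (rule sum.cong) auto
  then show ?thesis by simp
qed

lemma poly_act_pCons_0:
  assumes g: "g \<in> carrier G" and u: "u \<in> V"
  shows "poly_act g (pCons 0 p) u = \<rho> g (poly_act g p u)"
proof -
  have "poly_act g (pCons 0 p) u = (\<Sum>i\<le>Suc (degree p). coeff (pCons 0 p) i *s \<rho> (g [^] i) u)"
    by (rule poly_act_altdef) (rule degree_pCons_le)
  also have "\<dots> = (\<Sum>i\<le>degree p. coeff p i *s \<rho> (g [^] Suc i) u)"
    unfolding sum.atMost_Suc_shift by simp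
  also have "\<dots> = (\<Sum>i\<le>degree p. \<rho> g (coeff p i *s \<rho> (g [^] i) u))"
    using g u unfolding nat_pow_Suc2[OF g]
    by (intro sum.cong refl) (simp add: rep_scale rep_closed rep_mult)
  also have "\<dots> = \<rho> g (poly_act g p u)"
    unfolding poly_act_def using g u by (intro rep_sum[symmetric] V_scale rep_closed nat_pow_closed)
  finally show ?thesis .
qed

text \<open>If a nonzero vector is killed by a nonzero polynomial in \<open>g\<close>, then splitting off the linear
  factors of that polynomial one at a time reaches an eigenvector of \<open>g\<close>.\<close>

lemma eigenvector_if_annihilated:
  assumes g: "g \<in> carrier G" and u: "u \<in> V" "u \<noteq> 0"
    and "q \<noteq> 0" "poly_act g q u = 0"
  obtains \<mu> w where "w \<in> V" "w \<noteq> 0" "\<rho> g w = \<mu> *s w"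
  using assms(4,5)
proof (induction "degree q" arbitrary: q thesis)
  case 0
  then obtain c where "q = [:c:]" by (metis degree_eq_zeroE)
  with 0 have "c *s u = 0" "c \<noteq> 0" using u by (auto simp: poly_act_def rep_one)
  with u show ?case by simp
next
  case (Suc n)
  then have "\<not> constant (poly q)" by (simp add: constant_degree)
  then obtain z where "poly q z = 0" using fundamental_theorem_of_algebra by blast
  then obtain r where r: "q = [:- z, 1:] * r" by (metis poly_eq_0_iff_dvd dvdE)
  with Suc.prems have r0: "r \<noteq> 0" by auto
  then have deg: "n = degree r" using Suc.hyps(2) unfolding r by (subst (asm) degree_mult_eq) auto
  show ?case
  proof (cases "poly_act g r u = 0")
    case True
    with Suc.hyps(1)[OF deg] Suc.prems(1) r0 show ?thesis by blast
  next
    case False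
    have "q = pCons 0 r - smult z r" unfolding r by simp
    then have "\<rho> g (poly_act g r u) = z *s poly_act g r u"
      using Suc.prems(3) by (simp add: poly_act_diff poly_act_smult poly_act_pCons_0 g u)
    with False Suc.prems(1) show ?thesis using g u poly_act_in_V by blast
  qed
qed

end

section \<open>Recognising an irreducible representation as an induced one\<close>

context irreducible_rep
begin

lemma span_eq_V:
  assumes "S \<subseteq> V" "x \<in> S" "x \<noteq> 0"
    and "\<And>g x. \<lbrakk>g \<in> carrier G; x \<in> S\<rbrakk> \<Longrightarrow> \<rho> g x \<in> span S"
  shows "span S = V"
proof -
  have "span S = {0} \<or> span S = V"
    by (intro irreducible span_subset_V subspace_span assms(1))
      (rule rep_span[OF assms(1) _ assms(4)])
  moreover have "x \<in> span S" using assms(2) by (rule span_base)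
  ultimately show ?thesis using assms(3) by blast
qed

text \<open>Frobenius reciprocity: an \<open>H\<close>-equivariant functional \<open>\<phi>\<close> gives the intertwining map
  \<open>v \<mapsto> (g \<mapsto> \<phi> (\<rho> g v))\<close> into the induced representation. Its kernel is invariant, and it
  is not \<open>V\<close> because \<open>\<phi>\<close> does not vanish on \<open>V\<close>, so it is zero. A function in
  the induced space is determined by its values on a set \<open>R\<close> meeting all right cosets, so surjectivity only has to be tested on \<open>R\<close>.\<close>

lemma isomorphic_ind_if_functional:
  assumes H: "subgroup H G" and \<phi>: "Vector_Spaces.linear scale (*) \<phi>"
    and equivariant: "\<And>h v. \<lbrakk>h \<in> H; v \<in> V\<rbrakk> \<Longrightarrow> \<phi> (\<rho> h v) = \<chi> h * \<phi> v"
    and R: "finite R" "R \<subseteq> carrier G"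
    and cover: "\<And>g. g \<in> carrier G \<Longrightarrow> \<exists>h\<in>H. \<exists>x\<in>R. g = h \<otimes> x"
    and interpolate: "\<And>a. \<exists>v\<in>V. \<forall>x\<in>R. \<phi> (\<rho> x v) = a x"
  shows "rep_isomorphic G scale V \<rho>
    (fun_scale (*)) (ind_space G H UNIV (char_rep \<chi>)) (ind_act G)"
proof -
  interpret H: subgroup H G by fact
  interpret \<phi>: Vector_Spaces.linear scale "(*)" \<phi> by fact
  define T where "T v = (\<lambda>g. if g \<in> carrier G then \<phi> (\<rho> g v) else 0)" for v
  have T: "T v g = \<phi> (\<rho> g v)" if "g \<in> carrier G" for v g
    using that by (simp add: T_def)
  have T_in: "T v \<in> ind_space G H UNIV (char_rep \<chi>)" if v: "v \<in> V" for v
  proof -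
    have "(\<lambda>x. H #> x) ` R \<subseteq> rcosets H"
      using R(2) by (auto intro: rcosetsI H.subset)
    moreover have "carrier G \<subseteq> \<Union> ((\<lambda>x. H #> x) ` R)"
      using cover by (fastforce simp: r_coset_def)
    ultimately have "\<exists>C. finite C \<and> C \<subseteq> rcosets H \<and> {x \<in> carrier G. T v x \<noteq> 0} \<subseteq> \<Union>C"
      using R(1) by (intro exI[of _ "(\<lambda>x. H #> x) ` R"]) blast
    then show ?thesis
      using v by (simp add: ind_space_def T_def char_rep_def rep_mult rep_closed equivariant)
  qed
  define K where "K = {v \<in> V. \<forall>g\<in>carrier G. \<phi> (\<rho> g v) = 0}"
  have "subspace K"
    by (rule subspaceI)
      (auto simp: K_def V_closed rep_zero rep_add rep_scale \<phi>.zero \<phi>.add \<phi>.scale)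
  moreover have "K \<subseteq> V" by (auto simp: K_def)
  moreover have "\<rho> g w \<in> K" if "g \<in> carrier G" "w \<in> K" for g w
    using that by (auto simp: K_def rep_closed rep_mult[symmetric])
  ultimately have "K = {0} \<or> K = V" by (rule irreducible)
  moreover have "K \<noteq> V"
  proof -
    obtain x where "x \<in> R" using cover[OF one_closed] by blast
    moreover obtain v where "v \<in> V" "\<forall>x\<in>R. \<phi> (\<rho> x v) = 1"
      using interpolate[of "\<lambda>_. 1"] by blast
    ultimately show ?thesis using R(2) by (force simp: K_def)
  qed
  ultimately have K: "K = {0}" by blast
  have "inj_on T V"
  proof (rule inj_onI)
    fix v w assume v: "v \<in> V" and w: "w \<in> V" and eq: "T v = T w"
    have "\<phi> (\<rho> g (v - w)) = 0" if "g \<in> carrier G" for g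
      using fun_cong[OF eq, of g] that v w by (simp add: T rep_diff \<phi>.diff)
    then have "v - w \<in> K" using v w by (simp add: K_def V_diff)
    with K show "v = w" by simp
  qed
  moreover have "\<exists>v\<in>V. f = T v" if f: "f \<in> ind_space G H UNIV (char_rep \<chi>)" for f
  proof -
    obtain v where v: "v \<in> V" "\<forall>x\<in>R. \<phi> (\<rho> x v) = f x" using interpolate by blast
    have "f g = T v g" for g
    proof (cases "g \<in> carrier G")
      case True
      then obtain h x where hx: "h \<in> H" "x \<in> R" "g = h \<otimes> x" using cover by blast
      then have x: "x \<in> carrier G" using R(2) by blast
      have "f g = \<chi> h * f x" using f hx x by (simp add: ind_space_def char_rep_def)
      also have "\<dots> = T v g"
        using hx x v by (simp add: T rep_mult rep_closed equivariant)
      finally show ?thesis .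
    next
      case False
      then show ?thesis using f by (simp add: ind_space_def T_def)
    qed
    with v(1) show ?thesis by blast
  qed
  ultimately have "bij_betw T V (ind_space G H UNIV (char_rep \<chi>))"
    using T_in by (auto simp: bij_betw_def)
  then show ?thesis
    unfolding rep_isomorphic_def
    by (intro exI[of _ T])
      (auto simp: T_def fun_scale_def ind_act_def fun_eq_iff rep_add rep_scale rep_mult
        \<phi>.add \<phi>.scale rep_closed)
qed

lemma linear_functional_ex:
  assumes "independent B"
  shows "\<exists>\<phi>. Vector_Spaces.linear scale (*) \<phi> \<and> (\<forall>x\<in>B. \<phi> x = (f x :: complex))"
proof -
  interpret C: vector_space "(*) :: complex \<Rightarrow> complex \<Rightarrow> complex"
    by unfold_locales (simp_all add: algebra_simps)
  interpret P: vector_space_pair scale "(*) :: complex \<Rightarrow> complex \<Rightarrow> complex" ..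
  show ?thesis using assms by (rule P.linear_independent_extend)
qed

text \<open>A one-dimensional representation is its own character, induced from the whole group.\<close>

lemma isomorphic_ind_if_one_dimensional:
  assumes w: "w \<noteq> 0" "V = span {w}"
  shows "\<exists>\<chi>. \<chi> \<in> characters G \<and> rep_isomorphic G scale V \<rho>
    (fun_scale (*)) (ind_space G (carrier G) UNIV (char_rep \<chi>)) (ind_act G)"
proof -
  have "independent {w}" using w by simp
  then obtain \<phi> where \<phi>: "Vector_Spaces.linear scale (*) \<phi>" and \<phi>w: "\<phi> w = 1"
    using linear_functional_ex[of "{w}" "\<lambda>_. 1"] by auto
  interpret \<phi>: Vector_Spaces.linear scale "(*)" \<phi> by fact
  have wV: "w \<in> V" using w span_base by blast
  have V: "v = \<phi> v *s w" if "v \<in> V" for v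
    using that w(2) \<phi>w by (auto simp: span_singleton \<phi>.scale)
  define \<chi> where "\<chi> g = \<phi> (\<rho> g w)" for g
  have act: "\<phi> (\<rho> g v) = \<chi> g * \<phi> v" if "g \<in> carrier G" "v \<in> V" for g v
    using rep_scale[OF that(1) wV, of "\<phi> v"] V[OF that(2)] by (simp add: \<chi>_def \<phi>.scale)
  have mult: "\<chi> (g \<otimes> h) = \<chi> g * \<chi> h" if "g \<in> carrier G" "h \<in> carrier G" for g h
    using act[of g "\<rho> h w"] that wV by (simp add: \<chi>_def rep_mult rep_closed)
  have "\<chi> g \<noteq> 0" if "g \<in> carrier G" for g
    using mult[of g "inv g"] that \<phi>w by (auto simp: \<chi>_def rep_one wV)
  with mult have "\<chi> \<in> characters G"
    by (auto simp: characters_def hom_def complex_units_def)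
  moreover have "rep_isomorphic G scale V \<rho>
    (fun_scale (*)) (ind_space G (carrier G) UNIV (char_rep \<chi>)) (ind_act G)"
  proof (rule isomorphic_ind_if_functional[OF subgroup_self \<phi> act, of "{\<one>}"])
    show "\<exists>v\<in>V. \<forall>x\<in>{\<one>}. \<phi> (\<rho> x v) = a x" for a
      by (rule bexI[of _ "a \<one> *s w"]) (simp_all add: V_scale wV rep_one \<phi>.scale \<phi>w)
  qed auto
  ultimately show ?thesis by blast
qed

end

section \<open>The infinite dihedral group\<close>

lemma Dinf_simps [simp]:
  "(s, z) \<in> carrier Dinf \<longleftrightarrow> s = 1 \<or> s = -1"
  "(s, z) \<otimes>\<^bsub>Dinf\<^esub> (s', z') = (s * s', s' * z + z')"
  "\<one>\<^bsub>Dinf\<^esub> = (1, 0)"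
  by (auto simp: Dinf_def)

lemma Dinf_cases:
  assumes "g \<in> carrier Dinf"
  obtains n where "g = (1, n)" | n where "g = (-1, 0) \<otimes>\<^bsub>Dinf\<^esub> (1, n)"
  using assms by (cases g) auto

lemma Dinf_pow: "(1, 1) [^]\<^bsub>Dinf\<^esub> (n :: nat) = (1, int n)"
proof -
  interpret group Dinf by (rule group_Dinf)
  show ?thesis by (induction n) auto
qed

lemma subgroup_translations: "subgroup ({1} \<times> UNIV) Dinf"
proof -
  interpret group Dinf by (rule group_Dinf)
  have "inv\<^bsub>Dinf\<^esub> (1, n) = (1, - n)" for n
    by (rule inv_equality) auto
  then show ?thesis by (intro subgroupI) auto
qed

locale irreducible_rep_Dinf = irreducible_rep Dinf scale V \<rho>
  for scale :: "complex \<Rightarrow> 'v::ab_group_add \<Rightarrow> 'v" (infixr "*s" 75)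
    and V :: "'v set" and \<rho> :: "int \<times> int \<Rightarrow> 'v \<Rightarrow> 'v"
begin

text \<open>The translation by \<open>n\<close> and the reflection that generate the action.\<close>

abbreviation \<tau> :: "int \<Rightarrow> 'v \<Rightarrow> 'v" where "\<tau> n \<equiv> \<rho> (1, n)"
abbreviation \<sigma> :: "'v \<Rightarrow> 'v" where "\<sigma> \<equiv> \<rho> (-1, 0)"

lemma translation_add: "v \<in> V \<Longrightarrow> \<tau> m (\<tau> n v) = \<tau> (m + n) v"
  using rep_mult[of "(1, m)" "(1, n)" v] by simp

lemma reflection_twice: "v \<in> V \<Longrightarrow> \<sigma> (\<sigma> v) = v"
  using rep_mult[of "(-1, 0)" "(-1, 0)" v] rep_one[of v] by simp

lemma reflection_translation: "v \<in> V \<Longrightarrow> \<sigma> (\<tau> n v) = \<tau> (- n) (\<sigma> v)"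
  using rep_mult[of "(-1, 0)" "(1, n)" v] rep_mult[of "(1, - n)" "(-1, 0)" v] by simp

lemma span_invariant:
  assumes S: "S \<subseteq> V" and \<tau>: "\<And>n x. x \<in> S \<Longrightarrow> \<tau> n x \<in> span S"
    and \<sigma>: "\<And>x. x \<in> S \<Longrightarrow> \<sigma> x \<in> span S"
    and "g \<in> carrier Dinf" "x \<in> S"
  shows "\<rho> g x \<in> span S"
proof -
  have "\<sigma> (\<tau> n x) \<in> span S" for n
    using rep_span[OF S _ \<sigma>] \<tau>[OF \<open>x \<in> S\<close>] by simp
  with assms(4,5) S show ?thesis
    by (cases rule: Dinf_cases) (auto simp: \<tau> rep_mult subsetD simp del: Dinf_simps(2))
qed

lemma span_eq_V_Dinf:
  assumes "S \<subseteq> V" "x \<in> S" "x \<noteq> 0"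
    and "\<And>n x. x \<in> S \<Longrightarrow> \<tau> n x \<in> span S" "\<And>x. x \<in> S \<Longrightarrow> \<sigma> x \<in> span S"
  shows "span S = V"
  using assms(1-3) span_invariant[OF assms(1,4,5)] by (rule span_eq_V)

text \<open>Averaging a vector over the reflection gives a vector on which the reflection acts by a
  sign, unless the average vanishes, and then the vector itself has this property.\<close>

lemma reflection_eigenvector:
  assumes "u \<in> V" "u \<noteq> 0"
  obtains v \<epsilon> where "v \<in> {u, u + \<sigma> u}" "v \<in> V" "v \<noteq> 0" "\<sigma> v = \<epsilon> *s v"
proof (cases "u + \<sigma> u = 0")
  case True
  then have "\<sigma> u = (-1) *s u" by (simp add: eq_neg_iff_add_eq_0 add.commute)
  with assms that[of u] show ?thesis by blast
next
  case False
  have "\<sigma> (u + \<sigma> u) = 1 *s (u + \<sigma> u)"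
    using assms by (simp add: rep_add rep_closed reflection_twice add.commute)
  with False assms that[of "u + \<sigma> u" 1] show ?thesis by (simp add: V_add rep_closed)
qed

text \<open>The vectors \<open>\<tau> n v - \<tau> (n + 1) v\<close> span an invariant subspace when \<open>\<sigma>\<close> scales \<open>v\<close>: it is
  the image of the augmentation ideal of the group algebra of the translations. If it is zero, \<open>v\<close>
  is fixed by the translations. Otherwise it contains \<open>v\<close>, so \<open>v = p(\<tau> 1) v\<close> for a Laurent
  polynomial \<open>p\<close> with \<open>p(1) = 0\<close>; as \<open>p \<noteq> 1\<close>, a nonzero polynomial in \<open>\<tau> 1\<close> kills \<open>v\<close>.\<close>

lemma translation_eigenvector:
  obtains \<mu> u where "u \<in> V" "u \<noteq> 0" "\<tau> 1 u = \<mu> *s u"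
proof -
  obtain u where "u \<in> V" "u \<noteq> 0" using nonzero V_zero by blast
  then obtain v \<epsilon> where v: "v \<in> V" "v \<noteq> 0" "\<sigma> v = \<epsilon> *s v"
    by (rule reflection_eigenvector)
  define S where "S = range (\<lambda>n. \<tau> n v - \<tau> (n + 1) v)"
  have SV: "S \<subseteq> V" using v by (auto simp: S_def V_diff rep_closed)
  have \<tau>S: "\<tau> n x \<in> span S" if "x \<in> S" for n x
  proof -
    obtain m where "x = \<tau> m v - \<tau> (m + 1) v" using \<open>x \<in> S\<close> unfolding S_def by blast
    then have "\<tau> n x = \<tau> (n + m) v - \<tau> (n + m + 1) v"
      using v by (simp add: rep_diff rep_closed translation_add add.assoc)
    then show ?thesis by (auto simp: S_def intro: span_base)
  qed
  have \<sigma>S: "\<sigma> x \<in> span S" if "x \<in> S" for x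
  proof -
    obtain m where x: "x = \<tau> m v - \<tau> (m + 1) v" using \<open>x \<in> S\<close> unfolding S_def by blast
    let ?k = "- m - 1"
    have "\<sigma> x = \<epsilon> *s \<tau> (?k + 1) v - \<epsilon> *s \<tau> ?k v"
      using v by (simp add: x rep_diff rep_closed reflection_translation rep_scale)
    also have "\<dots> = (- \<epsilon>) *s (\<tau> ?k v - \<tau> (?k + 1) v)"
      by (simp add: algebra_simps)
    also have "\<dots> \<in> span S"
      unfolding S_def by (intro span_scale span_base) (rule rangeI)
    finally show ?thesis .
  qed
  have inv: "\<rho> g x \<in> span S" if "g \<in> carrier Dinf" "x \<in> S" for g x
    by (rule span_invariant[OF SV \<tau>S \<sigma>S that])
  have "span S = {0} \<or> span S = V"
    by (intro irreducible span_subset_V SV subspace_span) (rule rep_span[OF SV _ inv])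
  then show ?thesis
  proof
    assume "span S = {0}"
    moreover have "\<tau> 0 v - \<tau> (0 + 1) v \<in> span S"
      unfolding S_def by (intro span_base rangeI)
    ultimately have "\<tau> 1 v = 1 *s v" using rep_one[OF v(1)] by simp
    with v that show ?thesis by blast
  next
    assume "span S = V"
    with v have "v \<in> span S" by simp
    \<comment> \<open>Stated for all large \<open>M\<close>, so that the witnesses for two vectors have a common exponent
      and can be added.\<close>
    moreover have "w \<in> V \<and> (\<exists>N. \<forall>M\<ge>N. \<exists>p. poly p 1 = 0 \<and> \<tau> (int M) w = poly_act (1, 1) p v)"
      if "w \<in> span S" for w
      using that
    proof (induction rule: span_induct_alt)
      case base
      have "poly 0 (1 :: complex) = 0 \<and> \<tau> (int M) 0 = poly_act (1, 1) 0 v" for M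
        by (simp add: rep_zero poly_act_0)
      then show ?case using V_zero by blast
    next
      case (step c x y)
      then obtain m where x: "x = \<tau> m v - \<tau> (m + 1) v" by (auto simp: S_def)
      from step obtain N where N: "\<forall>M\<ge>N. \<exists>p. poly p 1 = 0 \<and> \<tau> (int M) y = poly_act (1, 1) p v"
        by blast
      have "\<exists>p. poly p 1 = 0 \<and> \<tau> (int M) (c *s x + y) = poly_act (1, 1) p v"
        if M: "M \<ge> max N (nat (- m))" for M
      proof -
        define k where "k = nat (int M + m)"
        have k: "int k = int M + m" using M unfolding k_def by linarith
        from M N obtain p where p: "poly p 1 = 0" "\<tau> (int M) y = poly_act (1, 1) p v" by auto
        let ?p = "smult c (monom 1 k - monom 1 (Suc k)) + p"
        have "\<tau> (int M) x = \<tau> (int k) v - \<tau> (int (Suc k)) v"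
          using v by (simp add: x rep_diff rep_closed translation_add k ac_simps)
        then have "\<tau> (int M) (c *s x + y) = poly_act (1, 1) ?p v"
          using step SV p by (simp add: subsetD rep_add rep_scale V_scale poly_act_add
            poly_act_smult poly_act_diff poly_act_monom Dinf_pow add.commute)
        moreover have "poly ?p 1 = 0" using p by (simp add: poly_monom)
        ultimately show ?thesis by blast
      qed
      moreover have "c *s x + y \<in> V" using step SV by (auto intro!: V_add V_scale)
      ultimately show ?case by blast
    qed
    ultimately obtain M p where p: "poly p 1 = 0" "\<tau> (int M) v = poly_act (1, 1) p v" by blast
    let ?q = "monom 1 M - p"
    have "poly ?q 1 = 1" using p by (simp add: poly_monom)
    then have "?q \<noteq> 0" by auto
    moreover have "poly_act (1, 1) ?q v = 0"
      using p by (simp add: poly_act_diff poly_act_monom Dinf_pow)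
    ultimately show ?thesis
      using eigenvector_if_annihilated[of "(1, 1)" v ?q] v that by auto
  qed
qed

lemma translation_powi:
  assumes u: "u \<in> V" "u \<noteq> 0" "\<tau> 1 u = \<mu> *s u"
  shows "\<mu> \<noteq> 0" "\<tau> n u = (\<mu> powi n) *s u"
proof -
  show \<mu>: "\<mu> \<noteq> 0" using u rep_inj[of "(1, 1)" u] by auto
  have "u = \<mu> *s \<tau> (- 1) u"
    using translation_add[of u "-1" 1] u rep_one[of u] by (simp add: rep_scale)
  then have "inverse \<mu> *s u = inverse \<mu> *s (\<mu> *s \<tau> (- 1) u)" by simp
  then have neg: "\<tau> (- 1) u = inverse \<mu> *s u" using \<mu> by simp
  show "\<tau> n u = (\<mu> powi n) *s u"
  proof (induction n rule: int_induct[where k = 0])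
    case base
    show ?case using rep_one[of u] u by simp
  next
    case (step1 i)
    then show ?case using translation_add[of u i 1] u \<mu>
      by (simp add: rep_scale power_int_add_1 mult.commute)
  next
    case (step2 i)
    then show ?case using translation_add[of u i "-1"] u \<mu> neg
      by (simp add: rep_scale power_int_diff field_simps)
  qed
qed

lemma translation_reflection_eigenvector:
  assumes u: "u \<in> V" "u \<noteq> 0" "\<tau> 1 u = \<mu> *s u"
  shows "\<tau> n (\<sigma> u) = (\<mu> powi (- n)) *s \<sigma> u"
  using reflection_translation[of u "- n"] translation_powi(2)[OF u, of "- n"] u
  by (simp add: rep_scale)

text \<open>If the eigenvalue is \<open>\<plusminus>1\<close>, then \<open>u\<close> and \<open>\<sigma> u\<close> have the same eigenvalue, and a combination of
  them spans an invariant line.\<close>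

lemma one_dimensional_if_eigenvalue_self_inverse:
  assumes u: "u \<in> V" "u \<noteq> 0" "\<tau> 1 u = \<mu> *s u" and \<mu>: "\<mu> * \<mu> = 1"
  shows "\<exists>w. w \<noteq> 0 \<and> V = span {w}"
proof -
  obtain w \<epsilon> where w: "w \<in> {u, u + \<sigma> u}" "w \<in> V" "w \<noteq> 0" "\<sigma> w = \<epsilon> *s w"
    using reflection_eigenvector[OF u(1,2)] by blast
  have "inverse \<mu> = \<mu>" using \<mu> by (rule inverse_unique)
  then have "\<tau> 1 (\<sigma> u) = \<mu> *s \<sigma> u"
    using translation_reflection_eigenvector[OF u, of 1] by (simp add: power_int_minus)
  then have "\<tau> 1 w = \<mu> *s w"
    using w(1) u by (auto simp: rep_add rep_closed scale_right_distrib)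
  then have "\<tau> n w = (\<mu> powi n) *s w" for n
    using translation_powi(2) w by blast
  with w have "span {w} = V"
    by (intro span_eq_V_Dinf[of _ w]) (auto intro: span_scale span_base)
  with w show ?thesis by blast
qed

text \<open>Otherwise \<open>u\<close> and \<open>\<sigma> u\<close> are eigenvectors for distinct eigenvalues and form a basis of \<open>V\<close>,
  and the coordinate of \<open>u\<close> is the functional needed for inducing from the translations.\<close>

lemma isomorphic_ind_translations:
  assumes u: "u \<in> V" "u \<noteq> 0" "\<tau> 1 u = \<mu> *s u" and \<mu>: "\<mu> * \<mu> \<noteq> 1"
  defines "H \<equiv> {1} \<times> UNIV" and "\<chi> \<equiv> \<lambda>g. \<mu> powi (snd g)"
  shows "\<chi> \<in> characters (Dinf\<lparr>carrier := H\<rparr>)"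
    and "rep_isomorphic Dinf scale V \<rho>
      (fun_scale (*)) (ind_space Dinf H UNIV (char_rep \<chi>)) (ind_act Dinf)"
proof -
  note \<mu>0 = translation_powi(1)[OF u]
  show "\<chi> \<in> characters (Dinf\<lparr>carrier := H\<rparr>)"
    using \<mu>0 by (auto simp: \<chi>_def H_def characters_def hom_def complex_units_def power_int_add)
  have \<sigma>u: "\<sigma> u \<in> V" "\<sigma> u \<noteq> 0"
    using u rep_inj[of "(-1, 0)" u] by (auto simp: rep_closed)
  have indep: "\<sigma> u \<notin> span {u}"
  proof
    assume "\<sigma> u \<in> span {u}"
    then obtain c where "\<sigma> u = c *s u" by (auto simp: span_singleton)
    then have "\<mu> *s \<sigma> u = \<tau> 1 (\<sigma> u)" using u by (simp add: rep_scale mult.commute)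
    also have "\<dots> = inverse \<mu> *s \<sigma> u"
      using translation_reflection_eigenvector[OF u, of 1] by (simp add: power_int_minus)
    finally have "\<mu> = inverse \<mu>" using \<sigma>u by simp
    with \<mu> \<mu>0 show False by (metis right_inverse)
  qed
  then have ne: "\<sigma> u \<noteq> u" using span_base[of u "{u}"] by auto
  have "independent {\<sigma> u, u}"
    using indep ne u by (simp add: independent_insert)
  then obtain \<phi> where \<phi>: "Vector_Spaces.linear scale (*) \<phi>" and \<phi>u: "\<phi> u = 1" "\<phi> (\<sigma> u) = 0"
    using linear_functional_ex[of "{\<sigma> u, u}" "\<lambda>x. if x = u then 1 else 0"] ne by auto
  interpret \<phi>: Vector_Spaces.linear scale "(*)" \<phi> by fact
  have V: "span {\<sigma> u, u} = V"
    using u \<sigma>u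
    by (intro span_eq_V_Dinf[of _ u])
      (auto simp: translation_powi(2)[OF u] translation_reflection_eigenvector[OF u]
        reflection_twice intro: span_base intro!: span_scale)
  have equivariant: "\<phi> (\<rho> h v) = \<chi> h * \<phi> v" if h: "h \<in> H" and v: "v \<in> V" for h v
  proof -
    obtain n where n: "h = (1, n)" using h by (auto simp: H_def)
    obtain a b where ab: "v = a *s \<sigma> u + b *s u"
      using v unfolding V[symmetric] span_insert by (auto simp: span_singleton algebra_simps)
    show ?thesis
      using u \<sigma>u \<phi>u by (simp add: ab n \<chi>_def rep_add rep_scale V_scale \<phi>.add \<phi>.scale
          translation_powi(2)[OF u] translation_reflection_eigenvector[OF u])
  qed
  show "rep_isomorphic Dinf scale V \<rho>
      (fun_scale (*)) (ind_space Dinf H UNIV (char_rep \<chi>)) (ind_act Dinf)"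
  proof (rule isomorphic_ind_if_functional[OF _ \<phi> equivariant, where R = "{(1, 0), (-1, 0)}"])
    show "subgroup H Dinf" unfolding H_def by (rule subgroup_translations)
    fix g assume "g \<in> carrier Dinf"
    then obtain s z where g: "g = (s, z)" "s = 1 \<or> s = -1" by (cases g) auto
    then have "g = (1, s * z) \<otimes>\<^bsub>Dinf\<^esub> (s, 0)" by auto
    with g show "\<exists>h\<in>H. \<exists>x\<in>{(1, 0), (-1, 0)}. g = h \<otimes>\<^bsub>Dinf\<^esub> x"
      unfolding H_def by blast
  next
    fix a :: "int \<times> int \<Rightarrow> complex"
    let ?v = "a (1, 0) *s u + a (-1, 0) *s \<sigma> u"
    have "\<phi> (\<rho> (1, 0) ?v) = a (1, 0)" "\<phi> (\<sigma> ?v) = a (-1, 0)"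
      using u \<sigma>u \<phi>u rep_one[of ?v]
      by (simp_all add: V_add V_scale rep_add rep_scale reflection_twice \<phi>.add \<phi>.scale)
    then show "\<exists>v\<in>V. \<forall>x\<in>{(1, 0), (-1, 0)}. \<phi> (\<rho> x v) = a x"
      using u \<sigma>u by (intro bexI[of _ ?v]) (auto intro!: V_add V_scale)
  qed auto
qed

end

theorem theorem1p5:
  fixes scale :: "complex \<Rightarrow> 'v::ab_group_add \<Rightarrow> 'v"
    and V :: "'v set" and \<rho> :: "int \<times> int \<Rightarrow> 'v \<Rightarrow> 'v"
  assumes "irreducible_rep Dinf scale V \<rho>"
  shows "\<exists>H \<chi>. subgroup H Dinf \<and> \<chi> \<in> characters (Dinf\<lparr>carrier := H\<rparr>) \<and>
    rep_isomorphic Dinf scale V \<rho>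
      (fun_scale (*)) (ind_space Dinf H UNIV (char_rep \<chi>)) (ind_act Dinf)"
proof -
  interpret irreducible_rep_Dinf scale V \<rho>
    using assms by (rule irreducible_rep_Dinf.intro)
  obtain \<mu> u where u: "u \<in> V" "u \<noteq> 0" "\<tau> 1 u = scale \<mu> u"
    by (rule translation_eigenvector)
  show ?thesis
  proof (cases "\<mu> * \<mu> = 1")
    case True
    then obtain w where "w \<noteq> 0" "V = span {w}"
      using one_dimensional_if_eigenvalue_self_inverse[OF u] by blast
    from isomorphic_ind_if_one_dimensional[OF this] obtain \<chi> where
      "\<chi> \<in> characters Dinf" "rep_isomorphic Dinf scale V \<rho>
        (fun_scale (*)) (ind_space Dinf (carrier Dinf) UNIV (char_rep \<chi>)) (ind_act Dinf)"
      by blast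
    then show ?thesis
      using subgroup_self by (intro exI[of _ "carrier Dinf"] exI[of _ \<chi>]) simp
  next
    case False
    then show ?thesis
      using subgroup_translations isomorphic_ind_translations[OF u] by blast
  qed
qed

end
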